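(* For every $\varepsilon > 0$ there exists a constant $C$ such that the following holds. Let $p = p(n) \in [0,1]$ satisfy $p > C/n$, and let $m := \binom{n}{\lfloor n/2 \rfloor}$. Then, with high probability, the largest antichain contained in the random family $\mathcal{P}(n,p)$ has size at most $(1+\varepsilon) p m$.
   Context: For a positive integer $n$, $[n] = \{1,\dots,n\}$ and $\mathcal{P}(n)$ denotes the power set of $[n]$. A family $\mathcal{A} \subseteq \mathcal{P}(n)$ is an antichain if for any $A, B \in \mathcal{A}$ with $A \subseteq B$ we have $A = B$. For $p \in [0,1]$, $\mathcal{P}(n,p)$ is the random subset of $\mathcal{P}(n)$ obtained by selecting each element of $\mathcal{P}(n)$ with probability $p$, independently of all other choices. "With high probability" means with probability tending to $1$ as $n \to \infty$. *)

theory Defs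
  imports "HOL-Probability.Probability"
begin

definition antichain :: "'a set set \<Rightarrow> bool" where
  "antichain \<A> \<longleftrightarrow> (\<forall>A\<in>\<A>. \<forall>B\<in>\<A>. A \<subseteq> B \<longrightarrow> A = B)"

(* The size of a largest antichain contained in F; only meaningful for finite F. *)
definition max_antichain_size :: "'a set set \<Rightarrow> nat" where
  "max_antichain_size \<F> = Max (card ` {\<A>. \<A> \<subseteq> \<F> \<and> antichain \<A>})"

(* The distribution of the random family P(n,p), for p in [0,1]; bernoulli_pmf truncates
   other values of p to this interval. *)
definition random_family :: "nat \<Rightarrow> real \<Rightarrow> nat set set pmf" where
  "random_family n p =
     map_pmf (\<lambda>f. {A \<in> Pow {1..n}. f A})
       (Pi_pmf (Pow {1..n}) False (\<lambda>_. bernoulli_pmf p))"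

end

theory Submission
  imports Defs "HOL-Combinatorics.Multiset_Permutations" "HOL-Real_Asymp.Real_Asymp"
begin

text \<open>
  Write \<open>m\<close> for the central binomial coefficient. On a uniformly random maximal chain, a family
  \<open>F\<close> has on average at least \<open>|F| / m\<close> members. If this exceeds \<open>r\<close>, many pairs of members lie
  on a common chain at least \<open>r\<close> levels apart, and each single pair is that lucky only rarely, so
  some member of \<open>F\<close> is comparable to \<open>\<Omega>(n ^ r)\<close> others. The graph container
  algorithm, run first with \<open>r = 4\<close> and then with \<open>r = 1\<close>, therefore places every antichain into
  a set of size about \<open>m\<close> that is determined by a fingerprint, a subset of the antichain of size
  \<open>O(m / n)\<close>. A union bound over the fingerprints (weighted by the probability that the
  random family contains them) against a Chernoff bound for each container gives the theorem once
  \<open>n * p\<close> is a large constant.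
\<close>

section \<open>Supersaturation for comparable pairs\<close>

text \<open>Such a permutation splits uniquely into an ordering of \<open>B\<close> followed by an
  ordering of \<open>S - B\<close>. The condition \<open>Q\<close> on the first block allows the
  same count to be iterated for a smaller set inside \<open>B\<close>.\<close>

lemma card_permutations_of_set_prefix:
  assumes "finite S" "B \<subseteq> S"
  shows "card {xs \<in> permutations_of_set S. set (take (card B) xs) = B \<and> Q (take (card B) xs)}
           = card {ys \<in> permutations_of_set B. Q ys} * fact (card S - card B)"
proof -
  have fB: "finite B" using assms finite_subset by auto
  let ?P = "{ys \<in> permutations_of_set B. Q ys}" and ?R = "permutations_of_set (S - B)"
  have len: "length ys = card B" if "ys \<in> permutations_of_set B" for ys
    using that by (rule length_finite_permutations_of_set)
  have "{xs \<in> permutations_of_set S. set (take (card B) xs) = B \<and> Q (take (card B) xs)}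
          = (\<lambda>(ys, zs). ys @ zs) ` (?P \<times> ?R)" (is "?L = _")
  proof (intro equalityI subsetI)
    fix xs assume xs: "xs \<in> ?L"
    then have d: "distinct xs" "set xs = S" by (auto simp: permutations_of_set_def)
    have "distinct (take (card B) xs @ drop (card B) xs)" using d by simp
    then have "set (take (card B) xs) \<inter> set (drop (card B) xs) = {}"
      by (simp only: distinct_append)
    moreover have "set (take (card B) xs) \<union> set (drop (card B) xs) = S"
      using d by (metis append_take_drop_id set_append)
    ultimately have "set (drop (card B) xs) = S - B" using xs by auto
    then have "(take (card B) xs, drop (card B) xs) \<in> ?P \<times> ?R"
      using xs d by (auto simp: permutations_of_set_def)
    moreover have "xs = (\<lambda>(ys, zs). ys @ zs) (take (card B) xs, drop (card B) xs)" by simp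
    ultimately show "xs \<in> (\<lambda>(ys, zs). ys @ zs) ` (?P \<times> ?R)" by (rule rev_image_eqI)
  next
    fix xs assume "xs \<in> (\<lambda>(ys, zs). ys @ zs) ` (?P \<times> ?R)"
    then obtain ys zs where "xs = ys @ zs" "ys \<in> ?P" "zs \<in> ?R" by auto
    then show "xs \<in> ?L" using len[of ys] assms(2) by (auto simp: permutations_of_set_def)
  qed
  moreover have "inj_on (\<lambda>(ys, zs). ys @ zs) (?P \<times> ?R)"
    by (auto simp: inj_on_def len)
  ultimately have "card ?L = card (?P \<times> ?R)" by (simp add: card_image)
  also have "\<dots> = card ?P * fact (card S - card B)"
    using assms fB by (simp add: card_cartesian_product card_Diff_subset)
  finally show ?thesis .
qed

lemma card_permutations_of_set_through:
  assumes "finite S" "A \<subseteq> S"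
  shows "card {xs \<in> permutations_of_set S. set (take (card A) xs) = A}
           = fact (card A) * fact (card S - card A)"
  using card_permutations_of_set_prefix[OF assms, of "\<lambda>_. True"] assms finite_subset by fastforce

lemma card_permutations_of_set_through2:
  assumes "finite S" "A \<subseteq> B" "B \<subseteq> S"
  shows "card {xs \<in> permutations_of_set S. set (take (card A) xs) = A \<and> set (take (card B) xs) = B}
           = fact (card A) * fact (card B - card A) * fact (card S - card B)"
proof -
  have fB: "finite B" using assms finite_subset by auto
  have "min (card A) (card B) = card A" using assms fB by (simp add: card_mono min_absorb1)
  then have "{xs \<in> permutations_of_set S. set (take (card A) xs) = A \<and> set (take (card B) xs) = B}
    = {xs \<in> permutations_of_set S. set (take (card B) xs) = B \<and>
         set (take (card A) (take (card B) xs)) = A}" by auto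
  then show ?thesis
    using card_permutations_of_set_prefix[OF assms(1,3), of "\<lambda>ys. set (take (card A) ys) = A"]
      card_permutations_of_set_through[OF fB assms(2)] by simp
qed

text \<open>The list \<open>xs\<close> stands for the maximal chain of the sets of its prefixes.
  Pair the smallest member on the chain with all members at least \<open>r\<close> levels above it;
  fewer than \<open>r\<close> members other than it are missed.\<close>
lemma card_on_chain_le:
  assumes "finite F"
  shows "card {A \<in> F. set (take (card A) xs) = A}
     \<le> r + card {(A, B). A \<in> F \<and> B \<in> F \<and> A \<subseteq> B \<and> card A + r \<le> card B \<and>
              set (take (card A) xs) = A \<and> set (take (card B) xs) = B}"
    (is "card ?X \<le> r + card ?Y")
proof (cases "?X = {}")
  case True
  show ?thesis by (simp only: True) simp
next
  case False
  have fX: "finite ?X" using assms by auto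
  define A where "A = arg_min_on card ?X"
  have A: "A \<in> ?X" and Amin: "\<And>B. B \<in> ?X \<Longrightarrow> card A \<le> card B"
    using arg_min_if_finite[OF fX False, of card] unfolding A_def by (auto simp: not_less)
  let ?N = "{B \<in> ?X. card B < card A + r}" and ?Z = "{B \<in> ?X. card A + r \<le> card B}"
  \<comment> \<open>A set on the chain is the prefix of its own cardinality, so each level holds at
    most one member and a window of \<open>r\<close> levels at most \<open>r\<close>.\<close>
  have "inj_on card ?X" by (rule inj_onI) (metis (mono_tags, lifting) mem_Collect_eq)
  then have "inj_on card ?N" by (rule inj_on_subset) auto
  then have "card ?N = card (card ` ?N)" by (simp add: card_image)
  also have "\<dots> \<le> card {card A..<card A + r}" using Amin by (intro card_mono) auto
  finally have N: "card ?N \<le> r" by simp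
  have sub: "A \<subseteq> B" if "B \<in> ?X" for B
    using that A Amin[OF that] set_take_subset_set_take[of "card A" "card B" xs] by auto
  have "finite ?Y" by (rule finite_subset[of _ "F \<times> F"]) (use assms in auto)
  moreover have "(\<lambda>B. (A, B)) ` ?Z \<subseteq> ?Y" using A sub by auto
  ultimately have "card ((\<lambda>B. (A, B)) ` ?Z) \<le> card ?Y" by (rule card_mono)
  then have Z: "card ?Z \<le> card ?Y" by (simp add: card_image inj_on_def)
  have "card ?X = card (?N \<union> ?Z)" by (rule arg_cong[of _ _ card]) auto
  also have "\<dots> \<le> card ?N + card ?Z" by (rule card_Un_le)
  finally show ?thesis using N Z by simp
qed

text \<open>This is the previous bound summed over all maximal chains.\<close>
lemma chain_weight_le:
  assumes "finite S" "F \<subseteq> Pow S"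
  shows "(\<Sum>A\<in>F. fact (card A) * fact (card S - card A))
     \<le> r * fact (card S) + (\<Sum>(A, B) \<in> {(A, B). A \<in> F \<and> B \<in> F \<and> A \<subseteq> B \<and> card A + r \<le> card B}.
          fact (card A) * fact (card B - card A) * fact (card S - card B) :: nat)"
proof -
  have fF: "finite F" using assms finite_subset by auto
  let ?P = "permutations_of_set S"
  let ?E = "{(A, B). A \<in> F \<and> B \<in> F \<and> A \<subseteq> B \<and> card A + r \<le> card B}"
  have fE: "finite ?E" by (rule finite_subset[of _ "F \<times> F"]) (use fF in auto)
  let ?on = "\<lambda>xs A. set (take (card A) xs) = A"
  have "(\<Sum>A\<in>F. fact (card A) * fact (card S - card A)) = (\<Sum>A\<in>F. card {xs \<in> ?P. ?on xs A})"
    using assms by (intro sum.cong refl) (auto simp: card_permutations_of_set_through)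
  \<comment> \<open>Double counting of the pairs formed by a member and a permutation whose chain
    passes through it.\<close>
  also have "\<dots> = (\<Sum>xs\<in>?P. card {A \<in> F. ?on xs A})"
    by (rule sum_multicount_gen[symmetric]) (use fF in auto)
  also have "\<dots> \<le> (\<Sum>xs\<in>?P. r + card {e \<in> ?E. ?on xs (fst e) \<and> ?on xs (snd e)})"
  proof (rule sum_mono)
    fix xs
    have "{e \<in> ?E. ?on xs (fst e) \<and> ?on xs (snd e)} = {(A, B). A \<in> F \<and> B \<in> F \<and> A \<subseteq> B \<and> card A + r \<le> card B \<and>
              set (take (card A) xs) = A \<and> set (take (card B) xs) = B}" by auto
    then show "card {A \<in> F. ?on xs A} \<le> r + card {e \<in> ?E. ?on xs (fst e) \<and> ?on xs (snd e)}"
      using card_on_chain_le[OF fF, of xs r] by simp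
  qed
  also have "\<dots> = r * fact (card S) + (\<Sum>xs\<in>?P. card {e \<in> ?E. ?on xs (fst e) \<and> ?on xs (snd e)})"
    using assms by (simp add: sum.distrib)
  also have "(\<Sum>xs\<in>?P. card {e \<in> ?E. ?on xs (fst e) \<and> ?on xs (snd e)})
      = (\<Sum>e\<in>?E. card {xs \<in> ?P. ?on xs (fst e) \<and> ?on xs (snd e)})"
    by (rule sum_multicount_gen) (use fE in auto)
  also have "\<dots> = (\<Sum>(A, B)\<in>?E. fact (card A) * fact (card B - card A) * fact (card S - card B))"
    using assms by (intro sum.cong refl) (auto simp: card_permutations_of_set_through2 subset_eq)
  finally show ?thesis .
qed

section \<open>Weights of comparable pairs and the degree bound\<close>

text \<open>Unimodality of the row: \<open>j\<close> lies between \<open>r\<close> and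
  \<open>k - r\<close>, and reflecting \<open>j\<close> to \<open>k - j\<close> past the middle
  leads back to the increasing half.\<close>

lemma binomial_le_binomial_between:
  assumes "r \<le> j" "r + j \<le> k"
  shows "k choose r \<le> k choose j"
proof (cases "2 * j \<le> k")
  case True
  then show ?thesis using assms by (intro binomial_mono) auto
next
  case False
  have "k choose r \<le> k choose (k - j)" using assms False by (intro binomial_mono) auto
  then show ?thesis using assms by (simp add: binomial_symmetric[of j k])
qed

text \<open>A pair of sets of sizes \<open>a < b\<close> shares the chains through the larger set with \<open>b choose a\<close>
  candidates, and those through the smaller one with \<open>(n - a) choose (b - a)\<close>; one of the two
  upper indices is at least \<open>n div 2\<close>.\<close>
lemma chain_pair_weight_le:
  fixes a b n r :: nat
  assumes "r \<le> a" "a + r \<le> b" "b + r \<le> n"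
  defines "Q \<equiv> (n div 2) choose r"
  shows "real Q * (fact a * fact (b - a) * fact (n - b))
      \<le> fact a * fact (n - a) + fact b * fact (n - b)"
proof (cases "n div 2 \<le> b")
  case True
  have "Q \<le> b choose r" unfolding Q_def using True by (rule binomial_right_mono)
  also have "\<dots> \<le> b choose a" using assms by (intro binomial_le_binomial_between) auto
  finally have "real Q \<le> real (b choose a)" by simp
  then have "real Q * (fact a * fact (b - a) * fact (n - b))
      \<le> real (b choose a) * (fact a * fact (b - a) * fact (n - b))"
    by (intro mult_right_mono) auto
  also have "\<dots> = fact b * fact (n - b)" using assms by (simp add: binomial_fact)
  finally show ?thesis by (smt (verit) fact_ge_zero mult_nonneg_nonneg)
next
  case False
  have "Q \<le> (n - a) choose r" unfolding Q_def using False assms by (intro binomial_right_mono) linarith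
  also have "\<dots> \<le> (n - a) choose (b - a)" using assms by (intro binomial_le_binomial_between) auto
  finally have "real Q \<le> real ((n - a) choose (b - a))" by simp
  then have "real Q * (fact a * fact (b - a) * fact (n - b))
      \<le> real ((n - a) choose (b - a)) * (fact a * fact (b - a) * fact (n - b))"
    by (intro mult_right_mono) auto
  also have "\<dots> = fact a * fact (n - a)" using assms by (simp add: binomial_fact)
  finally show ?thesis by (smt (verit) fact_ge_zero mult_nonneg_nonneg)
qed

text \<open>After multiplication by \<open>(n div 2) choose r\<close>, the chain weight of a pair at
  least \<open>r\<close> levels apart is at most the weight of its two endpoints together, so the
  pairs contribute at most \<open>d\<close> times the total weight of \<open>F\<close>. The
  resulting bound on the weight becomes a bound on the size because no level exceeds the central
  one.\<close>

lemma supersaturation: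
  fixes d :: real
  assumes "finite S" and n: "card S = n" and F: "F \<subseteq> {A. A \<subseteq> S \<and> r \<le> card A \<and> card A + r \<le> n}"
    and r: "r \<ge> 1"
    and deg: "\<And>A. A \<in> F \<Longrightarrow> real (card {B \<in> F. A \<subset> B \<or> B \<subset> A}) \<le> d"
    and d: "d < real ((n div 2) choose r)"
  shows "(1 - d / real ((n div 2) choose r)) * real (card F) \<le> real r * real (n choose (n div 2))"
proof -
  have FS: "F \<subseteq> Pow S" using F by auto
  have fF: "finite F" using FS assms(1) finite_subset by auto
  define Q where "Q = real ((n div 2) choose r)"
  \<comment> \<open>For \<open>A \<subseteq> S\<close> this is the number of maximal chains through
    \<open>A\<close>.\<close>
  define w where "w = (\<lambda>A::'a set. fact (card A) * fact (n - card A) :: real)"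
  have w0: "w A \<ge> 0" for A by (simp add: w_def)
  \<comment> \<open>\<open>?E\<close> collects the pairs charged by the chain count,
    \<open>?D\<close> all strictly nested pairs, which the degree hypothesis controls;
    \<open>r \<ge> 1\<close> makes \<open>?E\<close> a subset of \<open>?D\<close>.\<close>
  let ?E = "{(A, B). A \<in> F \<and> B \<in> F \<and> A \<subseteq> B \<and> card A + r \<le> card B}"
  let ?D = "{(A, B). A \<in> F \<and> B \<in> F \<and> A \<subset> B}"
  have fD: "finite ?D" by (rule finite_subset[of _ "F \<times> F"]) (use fF in auto)
  have ED: "?E \<subseteq> ?D" using r by auto
  have Q0: "Q \<ge> 0" by (simp add: Q_def)
  \<comment> \<open>A pair charges both of its endpoints, so every \<open>A\<close> collects
    \<open>w A\<close> once for each member comparable to it.\<close>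
  have sumD: "(\<Sum>(A, B)\<in>?D. w A + w B) = (\<Sum>A\<in>F. w A * card {B \<in> F. A \<subset> B \<or> B \<subset> A})"
  proof -
    have "(\<Sum>(A, B)\<in>?D. w A + w B) = (\<Sum>(A, B)\<in>?D. w A) + (\<Sum>(A, B)\<in>?D. w B)"
      by (simp add: sum.distrib case_prod_unfold)
    also have "(\<Sum>(A, B)\<in>?D. w A) = (\<Sum>A\<in>F. \<Sum>B\<in>{B\<in>F. A \<subset> B}. w A)"
      by (subst sum.Sigma) (use fF in \<open>auto intro!: sum.cong\<close>)
    also have "(\<Sum>(A, B)\<in>?D. w B) = (\<Sum>B\<in>F. \<Sum>A\<in>{A\<in>F. A \<subset> B}. w B)"
    proof -
      have "(\<Sum>(A, B)\<in>?D. w B) = (\<Sum>(B, A)\<in>(SIGMA B:F. {A\<in>F. A \<subset> B}). w B)"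
        by (rule sum.reindex_bij_witness[of _ prod.swap prod.swap]) auto
      then show ?thesis by (subst sum.Sigma) (use fF in auto)
    qed
    also have "(\<Sum>A\<in>F. \<Sum>B\<in>{B\<in>F. A \<subset> B}. w A) + (\<Sum>B\<in>F. \<Sum>A\<in>{A\<in>F. A \<subset> B}. w B)
        = (\<Sum>A\<in>F. w A * (card {B\<in>F. A \<subset> B} + card {B\<in>F. B \<subset> A}))"
      by (simp add: sum.distrib algebra_simps)
    also have "\<dots> = (\<Sum>A\<in>F. w A * card {B \<in> F. A \<subset> B \<or> B \<subset> A})"
    proof (intro sum.cong refl arg_cong2[where f = "(*)"])
      fix A
      have "card ({B\<in>F. A \<subset> B} \<union> {B\<in>F. B \<subset> A}) = card {B\<in>F. A \<subset> B} + card {B\<in>F. B \<subset> A}"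
        by (rule card_Un_disjoint) (use fF in auto)
      moreover have "{B\<in>F. A \<subset> B} \<union> {B\<in>F. B \<subset> A} = {B \<in> F. A \<subset> B \<or> B \<subset> A}" by auto
      ultimately show "real (card {B\<in>F. A \<subset> B} + card {B\<in>F. B \<subset> A})
          = real (card {B \<in> F. A \<subset> B \<or> B \<subset> A})" by simp
    qed
    finally show ?thesis .
  qed
  have "real (\<Sum>A\<in>F. fact (card A) * fact (card S - card A))
     \<le> real (r * fact (card S) + (\<Sum>(A, B) \<in> ?E.
          fact (card A) * fact (card B - card A) * fact (card S - card B)))"
    using chain_weight_le[OF assms(1) FS, of r] by (rule of_nat_mono)
  then have "sum w F \<le> r * fact n + (\<Sum>(A, B) \<in> ?E.
          fact (card A) * fact (card B - card A) * fact (n - card B))"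
    by (simp add: w_def n case_prod_unfold)
  then have "Q * sum w F \<le> Q * (r * fact n + (\<Sum>(A, B) \<in> ?E.
          fact (card A) * fact (card B - card A) * fact (n - card B)))"
    using Q0 by (rule mult_left_mono)
  also have "\<dots> = Q * r * fact n + (\<Sum>(A, B) \<in> ?E.
          Q * (fact (card A) * fact (card B - card A) * fact (n - card B)))"
    by (simp add: distrib_left sum_distrib_left case_prod_unfold)
  also have "(\<Sum>(A, B) \<in> ?E. Q * (fact (card A) * fact (card B - card A) * fact (n - card B)))
      \<le> (\<Sum>(A, B) \<in> ?E. w A + w B)"
    unfolding w_def Q_def by (rule sum_mono) (use F in \<open>auto intro!: chain_pair_weight_le\<close>)
  also have "\<dots> \<le> (\<Sum>(A, B) \<in> ?D. w A + w B)"
    by (rule sum_mono2[OF fD ED]) (use w0 in auto)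
  also have "\<dots> = (\<Sum>A\<in>F. w A * card {B \<in> F. A \<subset> B \<or> B \<subset> A})" by (rule sumD)
  also have "\<dots> \<le> (\<Sum>A\<in>F. w A * d)"
    by (rule sum_mono) (use deg w0 in \<open>auto intro!: mult_left_mono\<close>)
  also have "\<dots> = d * sum w F" by (simp add: sum_distrib_left mult.commute)
  finally have *: "(Q - d) * sum w F \<le> Q * r * fact n" by (simp add: algebra_simps)
  let ?m = "real (n choose (n div 2))"
  \<comment> \<open>As in the LYM inequality, every member has weight at least
    \<open>fact n / ?m\<close>.\<close>
  have wm: "fact n \<le> ?m * w A" if "A \<in> F" for A
  proof -
    have "card A \<le> n" using that F by auto
    then have "fact n = real (n choose card A) * w A"
      unfolding w_def by (simp add: binomial_fact)
    also have "\<dots> \<le> ?m * w A" by (intro mult_right_mono w0) (simp add: binomial_maximum)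
    finally show ?thesis .
  qed
  have "card F * fact n = (\<Sum>A\<in>F. fact n :: real)" by simp
  also have "\<dots> \<le> (\<Sum>A\<in>F. ?m * w A)" by (rule sum_mono) (use wm in auto)
  also have "\<dots> = ?m * sum w F" by (simp add: sum_distrib_left)
  finally have "(Q - d) * (card F * fact n) \<le> (Q - d) * (?m * sum w F)"
    using d by (intro mult_left_mono) (auto simp: Q_def)
  also have "\<dots> \<le> ?m * (Q * r * fact n)" using mult_left_mono[OF *, of ?m] by (simp add: mult.left_commute)
  finally have "(Q - d) * card F * fact n \<le> (Q * (r * ?m)) * fact n" by (simp add: algebra_simps)
  then have main: "(Q - d) * card F \<le> Q * (r * ?m)" by simp
  have "(1 - d / Q) * card F \<le> r * ?m"
  \<comment> \<open>For \<open>Q = 0\<close> one cannot cancel \<open>Q\<close>; but a member of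
    \<open>F\<close> would force \<open>2 * r \<le> n\<close> and hence \<open>Q > 0\<close>, so
    \<open>F\<close> is empty.\<close>
  proof (cases "Q = 0")
    case True
    have "F = {}"
    proof (rule ccontr)
      assume "F \<noteq> {}"
      then obtain A where "A \<in> F" by auto
      then have "r + r \<le> n" using F by auto
      then have "r \<le> n div 2" by simp
      then show False using True by (simp add: Q_def)
    qed
    then show ?thesis by simp
  next
    case False
    then have "Q > 0" using Q0 by simp
    have "Q * ((1 - d / Q) * card F) = (Q - d) * card F" using False by (simp add: field_simps)
    then show ?thesis using main \<open>Q > 0\<close> by (metis mult_le_cancel_left_pos)
  qed
  then show ?thesis by (simp add: Q_def)
qed

section \<open>Containers for antichains\<close>

text \<open>While the current set has more than \<open>M\<close> vertices, a vertex \<open>u\<close>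
  of degree at least \<open>d\<close> is queried for membership in \<open>I\<close>. A yes puts
  \<open>u\<close> into the fingerprint and deletes \<open>u\<close> and its neighbours, using up at
  least \<open>d\<close> vertices; a no deletes only \<open>u\<close>. The function \<open>g\<close>
  replays the answers from the fingerprint alone.\<close>

lemma graph_containers:
  fixes d M :: real
  assumes "finite U" and irr: "\<And>x. \<not> adj x x"
    and step: "\<And>W. W \<subseteq> U \<Longrightarrow> real (card W) > M \<Longrightarrow> \<exists>u\<in>W. real (card {v \<in> W. adj u v}) \<ge> d"
  shows "\<exists>g. (\<forall>T. g T \<subseteq> U \<and> real (card (g T)) \<le> M) \<and>
    (\<forall>I. I \<subseteq> U \<longrightarrow> (\<forall>x\<in>I. \<forall>y\<in>I. \<not> adj x y) \<longrightarrow>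
      (\<exists>T\<subseteq>I. real (card T) * d \<le> real (card U) \<and> I \<subseteq> T \<union> g T))"
  using assms(1) step
proof (induction U rule: finite_psubset_induct)
  case (psubset U)
  show ?case
  proof (cases "real (card U) \<le> M")
    case True
    then show ?thesis
      by (intro exI[of _ "\<lambda>_. U"]) (auto intro!: exI[of _ "{}"])
  next
    case False
    then obtain u where u: "u \<in> U" "real (card {v \<in> U. adj u v}) \<ge> d"
      using psubset.prems[of U] by auto
    \<comment> \<open>\<open>U0\<close> is what remains after the answer no, \<open>U1\<close> after
      the answer yes.\<close>
    define U0 where "U0 = U - {u}"
    define U1 where "U1 = U - {u} - {v \<in> U. adj u v}"
    have sub: "U0 \<subset> U" "U1 \<subset> U" using u by (auto simp: U0_def U1_def)
    have step: "\<exists>u\<in>W. d \<le> real (card {v \<in> W. adj u v})"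
      if "V \<subset> U" "W \<subseteq> V" "M < real (card W)" for V W
      using psubset.prems[of W] that by auto
    obtain g0 where g0: "\<And>T. g0 T \<subseteq> U0 \<and> real (card (g0 T)) \<le> M"
      "\<And>I. I \<subseteq> U0 \<Longrightarrow> (\<forall>x\<in>I. \<forall>y\<in>I. \<not> adj x y) \<Longrightarrow>
      (\<exists>T\<subseteq>I. real (card T) * d \<le> real (card U0) \<and> I \<subseteq> T \<union> g0 T)"
      using psubset.IH[OF sub(1) step[of U0]] sub by blast
    obtain g1 where g1: "\<And>T. g1 T \<subseteq> U1 \<and> real (card (g1 T)) \<le> M"
      "\<And>I. I \<subseteq> U1 \<Longrightarrow> (\<forall>x\<in>I. \<forall>y\<in>I. \<not> adj x y) \<Longrightarrow>
      (\<exists>T\<subseteq>I. real (card T) * d \<le> real (card U1) \<and> I \<subseteq> T \<union> g1 T)"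
      using psubset.IH[OF sub(2) step[of U1]] sub by blast
    \<comment> \<open>For the fingerprints built below, \<open>u \<in> T\<close> holds exactly when
      \<open>u \<in> I\<close>, so \<open>g\<close> enters the branch that was really taken.\<close>
    define g where "g = (\<lambda>T. if u \<in> T then g1 (T - {u}) else g0 T)"
    show ?thesis
    proof (intro exI[of _ g] conjI allI impI)
      show "g T \<subseteq> U" "real (card (g T)) \<le> M" for T
        using g0(1)[of T] g1(1)[of "T - {u}"] sub by (auto simp: g_def)
    next
      fix I assume I: "I \<subseteq> U" "\<forall>x\<in>I. \<forall>y\<in>I. \<not> adj x y"
      show "\<exists>T\<subseteq>I. real (card T) * d \<le> real (card U) \<and> I \<subseteq> T \<union> g T"
      proof (cases "u \<in> I")
        case False
        then have "I \<subseteq> U0" using I by (auto simp: U0_def)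
        then obtain T where T: "T \<subseteq> I" "real (card T) * d \<le> real (card U0)" "I \<subseteq> T \<union> g0 T"
          using g0(2)[OF \<open>I \<subseteq> U0\<close> I(2)] by auto
        moreover have "card U0 \<le> card U" using sub psubset.hyps by (intro card_mono) auto
        moreover have "g T = g0 T" using T False by (auto simp: g_def)
        ultimately show ?thesis by (intro exI[of _ T]) auto
      next
        case True
        have "I - {u} \<subseteq> U1" "\<forall>x\<in>I - {u}. \<forall>y\<in>I - {u}. \<not> adj x y"
          using I True by (auto simp: U1_def)
        from g1(2)[OF this] obtain T where T: "T \<subseteq> I - {u}" "real (card T) * d \<le> real (card U1)" "I - {u} \<subseteq> T \<union> g1 T"
          by auto
        have fT: "finite T" using T I psubset.hyps by (meson finite_Diff finite_subset)
        have uT: "u \<notin> T" using T by auto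
        have "card U = card (U1 \<union> ({u} \<union> {v \<in> U. adj u v}))"
          using u by (intro arg_cong[of _ _ card]) (auto simp: U1_def)
        also have "\<dots> = card U1 + card ({u} \<union> {v \<in> U. adj u v})"
          by (rule card_Un_disjoint) (use psubset.hyps in \<open>auto simp: U1_def\<close>)
        also have "card ({u} \<union> {v \<in> U. adj u v}) = Suc (card {v \<in> U. adj u v})"
          using psubset.hyps irr by simp
        finally have "real (card U) \<ge> real (card U1) + d" using u by simp
        then have "real (card (insert u T)) * d \<le> real (card U)"
          using T fT uT by (simp add: algebra_simps)
        moreover have "g (insert u T) = g1 T" using uT by (simp add: g_def)
        ultimately show ?thesis using T True by (intro exI[of _ "insert u T"]) auto
      qed
    qed
  qed
qed

text \<open>Supersaturation, read contrapositively with \<open>d\<close> the fraction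
  \<open>\<eta>\<close> of \<open>(n div 2) choose r\<close>, gives every family above the size
  bound a member of degree at least \<open>d\<close>. This is what \<open>graph_containers\<close>
  asks of the comparability graph, whose independent sets are the antichains.\<close>

lemma antichain_containers:
  fixes \<eta> :: real
  assumes "finite S" and n: "card S = n" and V: "V \<subseteq> {A. A \<subseteq> S \<and> r \<le> card A \<and> card A + r \<le> n}"
    and r: "1 \<le> r" "2 * r \<le> n" and \<eta>: "0 < \<eta>" "\<eta> < 1"
  shows "\<exists>g. (\<forall>T. g T \<subseteq> V \<and> real (card (g T)) \<le> real r * real (n choose (n div 2)) / (1 - \<eta>)) \<and>
    (\<forall>I. I \<subseteq> V \<longrightarrow> antichain I \<longrightarrow>
      (\<exists>T\<subseteq>I. real (card T) * (\<eta> * real ((n div 2) choose r)) \<le> real (card V) \<and> I \<subseteq> T \<union> g T))"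
proof -
  let ?M = "real r * real (n choose (n div 2)) / (1 - \<eta>)"
  let ?Q = "real ((n div 2) choose r)"
  have fV: "finite V" by (rule finite_subset[of _ "Pow S"]) (use V assms(1) in auto)
  have Q: "?Q > 0" using r by simp
  have "\<exists>u\<in>W. real (card {v \<in> W. u \<subset> v \<or> v \<subset> u}) \<ge> \<eta> * ?Q" if W: "W \<subseteq> V" "real (card W) > ?M" for W
  proof (rule ccontr)
    assume "\<not> ?thesis"
    then have "\<And>u. u \<in> W \<Longrightarrow> real (card {v \<in> W. u \<subset> v \<or> v \<subset> u}) \<le> \<eta> * ?Q" by force
    then have "(1 - \<eta> * ?Q / ?Q) * real (card W) \<le> real r * real (n choose (n div 2))"
      using W V Q \<eta> r by (intro supersaturation[OF assms(1) n]) auto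
    then show False using W(2) Q \<eta> by (simp add: field_simps)
  qed
  then obtain g where g: "\<And>T. g T \<subseteq> V \<and> real (card (g T)) \<le> ?M"
    "\<And>I. I \<subseteq> V \<Longrightarrow> (\<forall>x\<in>I. \<forall>y\<in>I. \<not> (x \<subset> y \<or> y \<subset> x)) \<Longrightarrow>
      (\<exists>T\<subseteq>I. real (card T) * (\<eta> * ?Q) \<le> real (card V) \<and> I \<subseteq> T \<union> g T)"
    using graph_containers[of V "\<lambda>u v. u \<subset> v \<or> v \<subset> u" ?M "\<eta> * ?Q"] fV by auto
  show ?thesis
  proof (intro exI[of _ g] conjI allI impI)
    fix I assume "I \<subseteq> V" "antichain I"
    moreover have "\<forall>x\<in>I. \<forall>y\<in>I. \<not> (x \<subset> y \<or> y \<subset> x)"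
      using \<open>antichain I\<close> unfolding antichain_def by blast
    ultimately show "\<exists>T\<subseteq>I. real (card T) * (\<eta> * ?Q) \<le> real (card V) \<and> I \<subseteq> T \<union> g T"
      using g(2) by simp
  qed (use g(1) in auto)
qed

text \<open>At most eight levels, the four lowest and the four highest, are concerned, each with at
  most \<open>n ^ 3\<close> sets. They lie too close to the ends for supersaturation with
  \<open>r = 4\<close>.\<close>

lemma card_extreme_subsets_le:
  assumes "finite S" "card S = n" "n \<ge> 1"
  shows "card {A. A \<subseteq> S \<and> \<not> (4 \<le> card A \<and> card A + 4 \<le> n)} \<le> 8 * n ^ 3"
proof -
  let ?K = "{..<4} \<union> {n - 3..n}"
  have le: "n choose k \<le> n ^ 3" if "k \<le> 3" for k
  proof (cases "k \<le> n")
    case True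
    then have "n choose k \<le> n ^ k" by (rule binomial_le_pow)
    also have "\<dots> \<le> n ^ 3" using that assms(3) by (intro power_increasing) auto
    finally show ?thesis .
  qed (simp add: binomial_eq_0)
  have le': "n choose k \<le> n ^ 3" if "k \<in> ?K" for k
  proof (cases "k \<le> 3")
    case False
    then have "k \<le> n" "n - k \<le> 3" using that by auto
    then show ?thesis using le[of "n - k"] by (simp add: binomial_symmetric[of k n])
  qed (use le in auto)
  have "{A. A \<subseteq> S \<and> \<not> (4 \<le> card A \<and> card A + 4 \<le> n)} \<subseteq> (\<Union>k\<in>?K. {A. A \<subseteq> S \<and> card A = k})"
    using assms card_mono[of S] by fastforce
  then have "card {A. A \<subseteq> S \<and> \<not> (4 \<le> card A \<and> card A + 4 \<le> n)}
      \<le> card (\<Union>k\<in>?K. {A. A \<subseteq> S \<and> card A = k})"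
    using assms by (intro card_mono) auto
  also have "\<dots> \<le> (\<Sum>k\<in>?K. card {A. A \<subseteq> S \<and> card A = k})" by (rule card_UN_le) auto
  also have "\<dots> = (\<Sum>k\<in>?K. n choose k)" using assms by (simp add: n_subsets)
  also have "\<dots> \<le> card ?K * n ^ 3" using sum_bounded_above[of ?K "\<lambda>k. n choose k" "n ^ 3"] le' by auto
  also have "\<dots> \<le> 8 * n ^ 3"
    using card_Un_le[of "{..<4::nat}" "{n - 3..n}"] by (intro mult_right_mono) auto
  finally show ?thesis .
qed

text \<open>The first round (\<open>r = 4\<close>) removes so many sets per chosen vertex that its fingerprints are
  negligible; the second round (\<open>r = 1\<close>) then starts from only \<open>O(m)\<close> sets.\<close>
lemma two_round_antichain_containers:
  fixes e :: real
  assumes "finite S" and n: "card S = n" "n \<ge> 8" and e: "e > 0"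
  defines "m \<equiv> real (n choose (n div 2))"
  shows "\<exists>G H. (\<forall>S1. G S1 \<subseteq> Pow S \<and> real (card (G S1)) \<le> 5 * m) \<and>
    (\<forall>S1 S2. H S1 S2 \<subseteq> Pow S \<and> real (card (H S1 S2)) \<le> (1 + e) * m + 8 * real n ^ 3) \<and>
    (\<forall>I. I \<subseteq> Pow S \<longrightarrow> antichain I \<longrightarrow> (\<exists>S1 S2. S1 \<subseteq> I \<and> S2 \<subseteq> I \<and> S2 \<subseteq> G S1 \<and>
       I \<subseteq> S1 \<union> S2 \<union> H S1 S2 \<and>
       real (card S1) * (real ((n div 2) choose 4) / 5) \<le> 2 ^ n \<and>
       real (card S2) * (e / (1 + e) * real (n div 2)) \<le> 5 * m))"
proof -
  define V where "V = {A. A \<subseteq> S \<and> 4 \<le> card A \<and> card A + 4 \<le> n}"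
  define X where "X = {A. A \<subseteq> S \<and> \<not> (4 \<le> card A \<and> card A + 4 \<le> n)}"
  have VX: "Pow S = V \<union> X" by (auto simp: V_def X_def)
  have cX: "real (card X) \<le> 8 * real n ^ 3"
  proof -
    have "card X \<le> 8 * n ^ 3"
      unfolding X_def using card_extreme_subsets_le[OF assms(1) n(1)] n(2) by auto
    then have "real (card X) \<le> real (8 * n ^ 3)" by (rule of_nat_mono)
    then show ?thesis by simp
  qed
  have cV: "real (card V) \<le> 2 ^ n"
  proof -
    have "card V \<le> card (Pow S)" using assms(1) by (intro card_mono) (auto simp: V_def)
    then have "real (card V) \<le> real (2 ^ n)" using assms(1) n by (simp add: card_Pow flip: of_nat_le_iff)
    then show ?thesis by simp
  qed
  \<comment> \<open>With \<open>r = 4\<close> and \<open>\<eta> = 1 / 5\<close>, the container bound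
    \<open>4 * m / (1 - \<eta>)\<close> is \<open>5 * m\<close>.\<close>
  obtain G where G: "\<And>T. G T \<subseteq> V \<and> real (card (G T)) \<le> 5 * m"
    "\<And>I. I \<subseteq> V \<Longrightarrow> antichain I \<Longrightarrow>
      (\<exists>T\<subseteq>I. real (card T) * (real ((n div 2) choose 4) / 5) \<le> real (card V) \<and> I \<subseteq> T \<union> G T)"
    using antichain_containers[OF assms(1) n(1), of V 4 "1 / 5"] n(2)
    unfolding m_def V_def by auto
  \<comment> \<open>The second round, to be run inside \<open>U = G T\<close> with
    \<open>r = 1\<close>; \<open>\<eta> = e / (1 + e)\<close> turns \<open>m / (1 - \<eta>)\<close>
    into \<open>(1 + e) * m\<close>.\<close>
  have "\<exists>g. (\<forall>T. g T \<subseteq> U \<and> real (card (g T)) \<le> (1 + e) * m) \<and>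
    (\<forall>I. I \<subseteq> U \<longrightarrow> antichain I \<longrightarrow>
      (\<exists>T\<subseteq>I. real (card T) * (e / (1 + e) * real (n div 2)) \<le> real (card U) \<and> I \<subseteq> T \<union> g T))"
    if "U \<subseteq> V" for U
  proof -
    have "1 - e / (1 + e) = 1 / (1 + e)" using e by (simp add: field_simps)
    then have M: "real 1 * m / (1 - e / (1 + e)) = (1 + e) * m" by simp
    have "U \<subseteq> {A. A \<subseteq> S \<and> 1 \<le> card A \<and> card A + 1 \<le> n}" using that by (auto simp: V_def)
    from antichain_containers[OF assms(1) n(1) this, of "e / (1 + e)"] show ?thesis
      using n(2) e unfolding m_def[symmetric] M by simp
  qed
  then have "\<forall>T. \<exists>g. (\<forall>T'. g T' \<subseteq> G T \<and> real (card (g T')) \<le> (1 + e) * m) \<and>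
    (\<forall>I. I \<subseteq> G T \<longrightarrow> antichain I \<longrightarrow>
      (\<exists>T'\<subseteq>I. real (card T') * (e / (1 + e) * real (n div 2)) \<le> real (card (G T)) \<and> I \<subseteq> T' \<union> g T'))"
    using G(1) by blast
  then obtain h where h: "\<And>T T'. h T T' \<subseteq> G T \<and> real (card (h T T')) \<le> (1 + e) * m"
    "\<And>T I. I \<subseteq> G T \<Longrightarrow> antichain I \<Longrightarrow>
      (\<exists>T'\<subseteq>I. real (card T') * (e / (1 + e) * real (n div 2)) \<le> real (card (G T)) \<and> I \<subseteq> T' \<union> h T T')"
    by metis
  show ?thesis
  \<comment> \<open>The extreme sets \<open>X\<close> stay out of both rounds and are added to every
    final container.\<close>
  proof (intro exI[of _ G] exI[of _ "\<lambda>S1 S2. h S1 S2 \<union> X"] conjI allI impI)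
    show "G S1 \<subseteq> Pow S" "real (card (G S1)) \<le> 5 * m" for S1 using G(1) VX by auto
    show "h S1 S2 \<union> X \<subseteq> Pow S" for S1 S2 using h(1)[of S1 S2] G(1)[of S1] VX by blast
    show "real (card (h S1 S2 \<union> X)) \<le> (1 + e) * m + 8 * real n ^ 3" for S1 S2
      using h(1)[of S1 S2] cX card_Un_le[of "h S1 S2" X] by linarith
  next
    fix I assume I: "I \<subseteq> Pow S" "antichain I"
    have sub: "antichain J" if "J \<subseteq> I" for J using I(2) that by (auto simp: antichain_def)
    obtain S1 where S1: "S1 \<subseteq> I \<inter> V" "real (card S1) * (real ((n div 2) choose 4) / 5) \<le> real (card V)"
      "I \<inter> V \<subseteq> S1 \<union> G S1"
      using G(2)[of "I \<inter> V"] sub by auto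
    obtain S2 where S2: "S2 \<subseteq> I \<inter> G S1"
      "real (card S2) * (e / (1 + e) * real (n div 2)) \<le> real (card (G S1))" "I \<inter> G S1 \<subseteq> S2 \<union> h S1 S2"
      using h(2)[of "I \<inter> G S1" S1] sub by auto
    have "I \<subseteq> S1 \<union> S2 \<union> (h S1 S2 \<union> X)" using I(1) VX S1(3) S2(3) by blast
    moreover have "real (card S2) * (e / (1 + e) * real (n div 2)) \<le> 5 * m"
      using S2(2) G(1)[of S1] by linarith
    moreover have "real (card S1) * (real ((n div 2) choose 4) / 5) \<le> 2 ^ n"
      using S1(2) cV by linarith
    ultimately show "\<exists>S1 S2. S1 \<subseteq> I \<and> S2 \<subseteq> I \<and> S2 \<subseteq> G S1 \<and>
       I \<subseteq> S1 \<union> S2 \<union> (h S1 S2 \<union> X) \<and>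
       real (card S1) * (real ((n div 2) choose 4) / 5) \<le> 2 ^ n \<and>
       real (card S2) * (e / (1 + e) * real (n div 2)) \<le> 5 * m"
      using S1(1) S2(1) by blast
  qed
qed

section \<open>The union bound\<close>

text \<open>Exponential tilting: for \<open>k \<le> s\<close> the factor
  \<open>t powr (k - s)\<close> is at least 1, so inserting it allows the size restriction to be
  dropped. The sum over all subsets is then \<open>(1 + p * t) ^ card V\<close> by the binomial
  theorem.\<close>

lemma sum_power_card_le:
  fixes p t s :: real
  assumes "finite V" "0 \<le> p" "0 < t" "t \<le> 1"
  shows "(\<Sum>T | T \<subseteq> V \<and> real (card T) \<le> s. p ^ card T) \<le> exp (s * ln (1 / t) + p * t * real (card V))"
proof -
  have "p ^ k \<le> exp (s * ln (1 / t)) * (p * t) ^ k" if "real k \<le> s" for k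
  proof -
    have "1 = exp (real k * ln (1 / t)) * t ^ k"
      using assms by (simp add: exp_of_nat_mult power_divide)
    also have "\<dots> \<le> exp (s * ln (1 / t)) * t ^ k"
      using that assms by (intro mult_right_mono) (auto intro!: mult_right_mono)
    finally have "p ^ k * 1 \<le> p ^ k * (exp (s * ln (1 / t)) * t ^ k)"
      using assms by (intro mult_left_mono) auto
    then show ?thesis by (simp add: power_mult_distrib mult_ac)
  qed
  then have "(\<Sum>T | T \<subseteq> V \<and> real (card T) \<le> s. p ^ card T)
      \<le> (\<Sum>T | T \<subseteq> V \<and> real (card T) \<le> s. exp (s * ln (1 / t)) * (p * t) ^ card T)"
    by (intro sum_mono) auto
  also have "\<dots> \<le> (\<Sum>T\<in>Pow V. exp (s * ln (1 / t)) * (p * t) ^ card T)"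
    using assms by (intro sum_mono2) auto
  also have "\<dots> = exp (s * ln (1 / t)) * (\<Sum>T\<in>Pow V. (p * t) ^ card T)" by (simp add: sum_distrib_left)
  also have "(\<Sum>T\<in>Pow V. (p * t) ^ card T) = (p * t + 1) ^ card V"
    using prod_add[OF assms(1), of "\<lambda>_. p * t" "\<lambda>_. 1"] by simp
  also have "\<dots> \<le> exp (p * t) ^ card V"
    using assms by (intro power_mono) (auto simp: add.commute exp_ge_add_one_self)
  finally show ?thesis by (simp add: exp_add exp_of_nat_mult[symmetric] mult_ac)
qed

text \<open>An exponential Markov inequality for the number of selected sets in \<open>T\<close>,
  combined with the indicator of \<open>S \<subseteq> F\<close>. Since \<open>S\<close> and
  \<open>T\<close> are disjoint, the expectation factors over coordinates into \<open>p\<close> on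
  \<open>S\<close> and \<open>1 + p * (exp \<theta> - 1)\<close> on \<open>T\<close>.\<close>

lemma prob_random_family_contains_and_large_le:
  fixes p a \<theta> :: real
  assumes p: "p \<in> {0..1}" and S: "S \<subseteq> Pow {1..n}" and T: "T \<subseteq> Pow {1..n}" and "S \<inter> T = {}" and "\<theta> \<ge> 0"
  shows "measure_pmf.prob (random_family n p) {F. S \<subseteq> F \<and> a \<le> real (card (F \<inter> T))}
           \<le> p ^ card S * exp (p * real (card T) * (exp \<theta> - 1) - \<theta> * a)"
proof -
  let ?U = "Pow {1..n}"
  let ?P = "Pi_pmf ?U False (\<lambda>_. bernoulli_pmf p)"
  \<comment> \<open>The product of these factors is the indicator of \<open>S \<subseteq> F\<close>
    times \<open>exp (\<theta> * card (F \<inter> T))\<close>.\<close>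
  define f where "f = (\<lambda>A b. if A \<in> S then of_bool b else if A \<in> T then (if b then exp \<theta> else 1) else 1 :: real)"
  define Fam where "Fam = (\<lambda>y::nat set \<Rightarrow> bool. {A \<in> ?U. y A})"
  have fin: "finite S" "finite T" using finite_subset[OF S] finite_subset[OF T] by auto
  have finP: "finite (set_pmf ?P)"
    by (rule finite_subset[OF set_Pi_pmf_subset']) auto
  have f0: "f A b \<ge> 0" for A b by (auto simp: f_def)
  have "measure_pmf.prob (random_family n p) {F. S \<subseteq> F \<and> a \<le> real (card (F \<inter> T))}
      = measure_pmf.prob ?P {y. S \<subseteq> Fam y \<and> a \<le> real (card (Fam y \<inter> T))}"
    by (simp add: random_family_def Fam_def vimage_def)
  also have "\<dots> = measure_pmf.expectation ?P (indicator {y. S \<subseteq> Fam y \<and> a \<le> real (card (Fam y \<inter> T))})"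
    by simp
  also have "\<dots> \<le> measure_pmf.expectation ?P (\<lambda>y. exp (- \<theta> * a) * (\<Prod>A\<in>?U. f A (y A)))"
  proof (rule integral_mono)
    fix y
    show "indicator {y. S \<subseteq> Fam y \<and> a \<le> real (card (Fam y \<inter> T))} y \<le> exp (- \<theta> * a) * (\<Prod>A\<in>?U. f A (y A))"
    proof (cases "S \<subseteq> Fam y \<and> a \<le> real (card (Fam y \<inter> T))")
      case True
      have "(\<Prod>A\<in>?U. f A (y A)) = (\<Prod>A\<in>Fam y \<inter> T. f A (y A))"
        by (rule prod.mono_neutral_right) (use True T in \<open>auto simp: f_def Fam_def\<close>)
      also have "\<dots> = (\<Prod>A\<in>Fam y \<inter> T. exp \<theta>)"
        using assms(4) by (intro prod.cong refl) (auto simp: f_def Fam_def)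
      also have "\<dots> = exp (\<theta> * card (Fam y \<inter> T))" by (simp add: exp_of_nat_mult[symmetric] mult.commute)
      finally have "exp (- \<theta> * a) * (\<Prod>A\<in>?U. f A (y A)) = exp (\<theta> * (card (Fam y \<inter> T) - a))"
        by (simp add: exp_add[symmetric] algebra_simps)
      also have "\<dots> \<ge> 1" using True assms(5) by simp
      finally show ?thesis using True by simp
    qed (simp add: prod_nonneg f0)
  qed (rule integrable_measure_pmf_finite[OF finP])+
  \<comment> \<open>Independence of the coordinates turns the expectation of the product into a
    product of expectations.\<close>
  also have "\<dots> = exp (- \<theta> * a) * (\<Prod>A\<in>?U. measure_pmf.expectation (bernoulli_pmf p) (f A))"
    by (subst integral_mult_right_zero, subst expectation_prod_Pi_pmf)
       (auto intro!: integrable_measure_pmf_finite f0)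
  also have "(\<Prod>A\<in>?U. measure_pmf.expectation (bernoulli_pmf p) (f A))
      = (\<Prod>A\<in>?U. if A \<in> S then p else if A \<in> T then 1 + p * (exp \<theta> - 1) else 1)"
    using p by (intro prod.cong refl) (auto simp: f_def algebra_simps)
  also have "\<dots> = (\<Prod>A\<in>S \<union> T. if A \<in> S then p else if A \<in> T then 1 + p * (exp \<theta> - 1) else 1)"
    by (rule prod.mono_neutral_right) (use S T in auto)
  also have "\<dots> = (\<Prod>A\<in>S. p) * (\<Prod>A\<in>T. 1 + p * (exp \<theta> - 1))"
    unfolding prod.union_disjoint[OF fin assms(4)]
    by (intro arg_cong2[where f = "(*)"] prod.cong refl) (use assms(4) in auto)
  finally have "measure_pmf.prob (random_family n p) {F. S \<subseteq> F \<and> a \<le> real (card (F \<inter> T))}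
      \<le> exp (- \<theta> * a) * (p ^ card S * (1 + p * (exp \<theta> - 1)) ^ card T)" by simp
  also have "\<dots> \<le> exp (- \<theta> * a) * (p ^ card S * exp (p * (exp \<theta> - 1)) ^ card T)"
    using p assms(5) by (intro mult_left_mono power_mono) auto
  also have "\<dots> = p ^ card S * (exp (real (card T) * (p * (exp \<theta> - 1))) * exp (- \<theta> * a))"
    by (simp add: exp_of_nat_mult)
  also have "\<dots> = p ^ card S * exp (p * real (card T) * (exp \<theta> - 1) - \<theta> * a)"
    unfolding exp_add[symmetric] by (simp add: algebra_simps)
  finally show ?thesis .
qed

lemma max_antichain_size_attained:
  assumes "finite F"
  obtains I where "I \<subseteq> F" "antichain I" "card I = max_antichain_size F"
proof -
  let ?C = "{I. I \<subseteq> F \<and> antichain I}"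
  have "finite ?C" using assms by simp
  moreover have "{} \<in> ?C" by (simp add: antichain_def)
  ultimately have "Max (card ` ?C) \<in> card ` ?C" by (intro Max_in) auto
  then show ?thesis using that by (auto simp: max_antichain_size_def)
qed

text \<open>A large antichain yields fingerprints \<open>S1\<close>, \<open>S2\<close> such that the
  random family contains \<open>S2\<close> and has at least \<open>a\<close> further sets in the
  container. In the union bound the choices of \<open>S1\<close> are merely counted, whereas each
  \<open>S2\<close> carries the probability \<open>p ^ card S2\<close> of being contained in the
  family.\<close>

lemma prob_large_antichain_le:
  fixes p s1 s2 a t \<theta> N M x :: real
  assumes p: "p \<in> {0..1}" and t: "0 < t" "t \<le> 1" and \<theta>: "\<theta> \<ge> 0"
    and G: "\<And>S1. G S1 \<subseteq> Pow {1..n}" "\<And>S1. real (card (G S1)) \<le> N"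
    and H: "\<And>S1 S2. H S1 S2 \<subseteq> Pow {1..n}" "\<And>S1 S2. real (card (H S1 S2)) \<le> M"
    and cover: "\<And>I. I \<subseteq> Pow {1..n} \<Longrightarrow> antichain I \<Longrightarrow> \<exists>S1 S2. S1 \<subseteq> I \<and> S2 \<subseteq> I \<and> S2 \<subseteq> G S1 \<and>
       I \<subseteq> S1 \<union> S2 \<union> H S1 S2 \<and> real (card S1) \<le> s1 \<and> real (card S2) \<le> s2"
    and x: "s1 + s2 + a \<le> x"
  shows "measure_pmf.prob (random_family n p) {F. x < real (max_antichain_size F)}
    \<le> exp (s1 * (real n * ln 2) + 1 + (s2 * ln (1 / t) + p * t * N) + (p * M * (exp \<theta> - 1) - \<theta> * a))"
proof -
  let ?P = "random_family n p"
  define J1 where "J1 = {T. T \<subseteq> Pow {1..n} \<and> real (card T) \<le> s1}"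
  define J2 where "J2 = (\<lambda>S1. {T. T \<subseteq> G S1 \<and> real (card T) \<le> s2})"
  \<comment> \<open>Removing \<open>S2\<close> from the container makes the two conditions depend on
    disjoint sets of coordinates.\<close>
  define E where "E = (\<lambda>S1 S2. {F. S2 \<subseteq> F \<and> a \<le> real (card (F \<inter> (H S1 S2 - S2)))})"
  define c where "c = exp (p * M * (exp \<theta> - 1) - \<theta> * a)"
  have fG: "finite (G S1)" for S1 using G(1)[of S1] by (rule finite_subset) simp
  have fJ1: "finite J1" unfolding J1_def by (rule finite_subset[of _ "Pow (Pow {1..n})"]) auto
  have fJ2: "finite (J2 S1)" for S1
    unfolding J2_def by (rule finite_subset[of _ "Pow (G S1)"]) (use fG in auto)
  have event: "{F. x < real (max_antichain_size F)} \<inter> set_pmf ?P \<subseteq> (\<Union>S1\<in>J1. \<Union>S2\<in>J2 S1. E S1 S2)"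
  proof
    fix F assume F: "F \<in> {F. x < real (max_antichain_size F)} \<inter> set_pmf ?P"
    then have FU: "F \<subseteq> Pow {1..n}" by (auto simp: random_family_def)
    then have fF: "finite F" by (rule finite_subset) simp
    then obtain I where I: "I \<subseteq> F" "antichain I" "card I = max_antichain_size F"
      by (rule max_antichain_size_attained)
    have IU: "I \<subseteq> Pow {1..n}" using I FU by (meson order_trans)
    obtain S1 S2 where S: "S1 \<subseteq> I" "S2 \<subseteq> I" "S2 \<subseteq> G S1" "I \<subseteq> S1 \<union> S2 \<union> H S1 S2"
      "real (card S1) \<le> s1" "real (card S2) \<le> s2"
      using cover[OF IU I(2)] by auto
    have fS: "finite S1" "finite S2" using finite_subset[OF I(1) fF] S(1,2) finite_subset by auto
    have "I \<subseteq> S1 \<union> (S2 \<union> (F \<inter> (H S1 S2 - S2)))" using S(4) I(1) by blast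
    then have "card I \<le> card (S1 \<union> (S2 \<union> (F \<inter> (H S1 S2 - S2))))"
      using fS fF by (intro card_mono) auto
    also have "\<dots> \<le> card S1 + (card S2 + card (F \<inter> (H S1 S2 - S2)))"
      using card_Un_le[of S1 "S2 \<union> (F \<inter> (H S1 S2 - S2))"] card_Un_le[of S2 "F \<inter> (H S1 S2 - S2)"]
      by linarith
    finally have "x < real (card S1 + (card S2 + card (F \<inter> (H S1 S2 - S2))))" using F I(3) by auto
    then have "F \<in> E S1 S2" using x S I(1) by (auto simp: E_def)
    moreover have "S1 \<in> J1" "S2 \<in> J2 S1" using S IU by (auto simp: J1_def J2_def)
    ultimately show "F \<in> (\<Union>S1\<in>J1. \<Union>S2\<in>J2 S1. E S1 S2)" by blast
  qed
  have E: "measure_pmf.prob ?P (E S1 S2) \<le> p ^ card S2 * c" if "S2 \<in> J2 S1" for S1 S2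
  proof -
    have "measure_pmf.prob ?P (E S1 S2)
        \<le> p ^ card S2 * exp (p * real (card (H S1 S2 - S2)) * (exp \<theta> - 1) - \<theta> * a)"
      unfolding E_def using that G(1)[of S1] H(1)[of S1 S2]
      by (intro prob_random_family_contains_and_large_le p \<theta>) (auto simp: J2_def)
    also have "\<dots> \<le> p ^ card S2 * c"
    proof -
      have "finite (H S1 S2)" using H(1) by (rule finite_subset) simp
      then have "card (H S1 S2 - S2) \<le> card (H S1 S2)" by (intro card_mono) auto
      then have "real (card (H S1 S2 - S2)) \<le> M" using H(2)[of S1 S2] by linarith
      then show ?thesis unfolding c_def using p \<theta>
        by (intro mult_left_mono) (auto intro!: mult_right_mono mult_left_mono)
    qed
    finally show ?thesis .
  qed
  have c0: "c \<ge> 0" by (simp add: c_def)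
  have S2: "(\<Sum>S2\<in>J2 S1. p ^ card S2) \<le> exp (s2 * ln (1 / t) + p * t * N)" for S1
  proof -
    have "(\<Sum>S2\<in>J2 S1. p ^ card S2) \<le> exp (s2 * ln (1 / t) + p * t * real (card (G S1)))"
      unfolding J2_def using fG p t by (intro sum_power_card_le) auto
    also have "\<dots> \<le> exp (s2 * ln (1 / t) + p * t * N)"
      using p t G(2)[of S1] by (auto intro!: mult_left_mono)
    finally show ?thesis .
  qed
  \<comment> \<open>Weight \<open>1\<close> in place of \<open>p\<close> turns the sum into a count,
    and \<open>t = 1 / 2 ^ n\<close> makes the last summand of the exponent equal to
    \<open>1\<close>.\<close>
  have "(\<Sum>S1\<in>J1. 1 ^ card S1) \<le> exp (s1 * ln (1 / (1 / 2 ^ n)) + 1 * (1 / 2 ^ n) * real (card (Pow {1..n})))"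
    unfolding J1_def by (intro sum_power_card_le) auto
  then have S1: "real (card J1) \<le> exp (s1 * (real n * ln 2) + 1)"
    by (simp add: card_Pow ln_realpow)
  have "measure_pmf.prob ?P {F. x < real (max_antichain_size F)}
      = measure_pmf.prob ?P ({F. x < real (max_antichain_size F)} \<inter> set_pmf ?P)"
    by (rule measure_Int_set_pmf[symmetric])
  also have "\<dots> \<le> measure_pmf.prob ?P (\<Union>S1\<in>J1. \<Union>S2\<in>J2 S1. E S1 S2)"
    by (intro measure_pmf.finite_measure_mono event) auto
  also have "\<dots> \<le> (\<Sum>S1\<in>J1. measure_pmf.prob ?P (\<Union>S2\<in>J2 S1. E S1 S2))"
    by (intro measure_pmf.finite_measure_subadditive_finite fJ1) auto
  also have "\<dots> \<le> (\<Sum>S1\<in>J1. \<Sum>S2\<in>J2 S1. measure_pmf.prob ?P (E S1 S2))"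
    by (intro sum_mono measure_pmf.finite_measure_subadditive_finite fJ2) auto
  also have "\<dots> \<le> (\<Sum>S1\<in>J1. \<Sum>S2\<in>J2 S1. p ^ card S2 * c)"
    by (intro sum_mono E) auto
  also have "\<dots> = (\<Sum>S1\<in>J1. (\<Sum>S2\<in>J2 S1. p ^ card S2) * c)" by (simp add: sum_distrib_right)
  also have "\<dots> \<le> (\<Sum>S1\<in>J1. exp (s2 * ln (1 / t) + p * t * N) * c)"
    by (intro sum_mono mult_right_mono S2 c0)
  also have "\<dots> = real (card J1) * (exp (s2 * ln (1 / t) + p * t * N) * c)" by simp
  also have "\<dots> \<le> exp (s1 * (real n * ln 2) + 1) * (exp (s2 * ln (1 / t) + p * t * N) * c)"
    using c0 by (intro mult_right_mono S1) auto
  finally show ?thesis by (simp add: c_def exp_add mult.assoc)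
qed

section \<open>Choice of parameters and passage to the limit\<close>

lemma central_binomial_ge: "2 ^ n / real (n + 1) \<le> real (n choose (n div 2))"
proof -
  have "2 ^ n = (\<Sum>k\<le>n. n choose k)" by (rule choose_row_sum[symmetric])
  also have "\<dots> \<le> (\<Sum>k\<le>n. n choose (n div 2))" by (intro sum_mono binomial_maximum)
  finally have "2 ^ n \<le> (n + 1) * (n choose (n div 2))" by simp
  then have "real (2 ^ n) \<le> real ((n + 1) * (n choose (n div 2)))" by (rule of_nat_mono)
  then show ?thesis by (simp add: field_simps)
qed

text \<open>The conditions on \<open>n\<close> and \<open>n * p\<close> keep the entropy of the fingerprints below three quarters
  of the Chernoff exponent \<open>e\<^sup>2 * p * m / 3\<close>. The constant \<open>103680\<close> is \<open>5 * 12 ^ 4\<close>, from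
  \<open>(n div 2) choose 4 \<ge> (n / 12) ^ 4\<close>.\<close>
lemma prob_large_antichain_le_exp:
  fixes p e :: real
  assumes p: "p \<in> {0..1}" and e: "0 < e" "e \<le> 1" and n: "n \<ge> 8"
  defines "m \<equiv> real (n choose (n div 2))"
  assumes n1: "8 * real n ^ 3 \<le> e * m"
    and n2: "103680 * (real n + 1) / real n ^ 2 \<le> e\<^sup>2 / 24" and n3: "1 \<le> e\<^sup>2 / 24 * (m / real n)"
    and p1: "1 \<le> real n * p" and p2: "30 / e\<^sup>2 \<le> real n * p"
    and p3: "360 * ln (60 / e\<^sup>2) / e ^ 3 \<le> real n * p"
  shows "measure_pmf.prob (random_family n p) {F. (1 + 6 * e) * p * m < real (max_antichain_size F)}
    \<le> exp (- (e\<^sup>2 / 12 * (m / real n)))"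
proof -
  define h where "h = real (n div 2)"
  define Q where "Q = real ((n div 2) choose 4)"
  \<comment> \<open>The fingerprint sizes allowed by the two rounds; \<open>s2\<close> comes from
    \<open>e / (1 + e) \<ge> e / 2\<close> and \<open>n div 2 \<ge> n / 3\<close>.\<close>
  define s1 where "s1 = 5 * 2 ^ n / Q"
  define s2 where "s2 = 30 * m / (e * real n)"
  \<comment> \<open>Chosen so that \<open>p * t * (5 * m)\<close> is exactly
    \<open>e\<^sup>2 / 12 * (p * m)\<close>.\<close>
  define t where "t = e\<^sup>2 / 60"
  have m0: "m \<ge> 0" by (simp add: m_def)
  have n0: "real n > 0" using n by simp
  have h: "real n / 3 \<le> h" unfolding h_def using n by linarith
  have Q: "(real n / 12) ^ 4 \<le> Q"
  proof -
    have "(real n / 12) ^ 4 \<le> (h / 4) ^ 4" using h by (intro power_mono) auto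
    also have "\<dots> \<le> Q" unfolding h_def Q_def
      using binomial_ge_n_over_k_pow_k[of 4 "n div 2", where 'a = real] n by simp
    finally show ?thesis .
  qed
  have Q0: "Q > 0" using n by (simp add: Q_def)
  have two: "2 ^ n \<le> (real n + 1) * m"
    using central_binomial_ge[of n] by (simp add: m_def field_simps)
  have "s1 \<le> 5 * ((real n + 1) * m) / (real n / 12) ^ 4"
    unfolding s1_def using two Q n0 m0 by (intro frac_le mult_left_mono) auto
  also have "\<dots> = 103680 * (real n + 1) / real n ^ 2 * (m / real n ^ 2)"
    using n0 by (simp add: field_simps power_divide eval_nat_numeral)
  also have "\<dots> \<le> e\<^sup>2 / 24 * (m / real n ^ 2)" using n2 m0 by (intro mult_right_mono) auto
  finally have "s1 * real n \<le> e\<^sup>2 / 24 * (m / real n ^ 2) * real n" using n0 by (intro mult_right_mono) auto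
  also have "\<dots> = e\<^sup>2 / 24 * (m / real n)" using n0 by (simp add: field_simps power2_eq_square)
  finally have s1n: "s1 * real n \<le> e\<^sup>2 / 24 * (m / real n)" .
  have s10: "s1 \<ge> 0" using Q0 by (simp add: s1_def)
  \<comment> \<open>Through \<open>n * p \<ge> 1\<close>, bounds in terms of \<open>m / n\<close>
    become bounds in terms of \<open>p * m\<close>.\<close>
  have mp: "m / real n \<le> p * m"
    using mult_right_mono[OF p1 m0] n0 by (simp add: field_simps)
  have pm0: "p * m \<ge> 0" using p m0 by simp
  have e2: "e\<^sup>2 \<le> e" using e by (simp add: power2_eq_square mult_left_le)
  have s1_small: "s1 \<le> e * (p * m)"
  proof -
    have "s1 * 1 \<le> s1 * real n" using s10 n by (intro mult_left_mono) auto
    also have "\<dots> \<le> e\<^sup>2 / 24 * (m / real n)" by (rule s1n)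
    also have "\<dots> \<le> e * (p * m)" using e2 e m0 mp by (intro mult_mono) auto
    finally show ?thesis by simp
  qed
  have entropy1: "s1 * (real n * ln 2) + 1 \<le> e\<^sup>2 / 12 * (p * m)"
  proof -
    have "s1 * (real n * ln 2) \<le> s1 * (real n * 1)"
      using s10 ln2_le_25_over_36 by (intro mult_left_mono) auto
    then have "s1 * (real n * ln 2) + 1 \<le> e\<^sup>2 / 12 * (m / real n)" using s1n n3 by simp
    also have "\<dots> \<le> e\<^sup>2 / 12 * (p * m)" using mp by (intro mult_left_mono) auto
    finally show ?thesis .
  qed
  have s2_small: "s2 \<le> e * (p * m)"
  proof -
    have "s2 = 30 / e\<^sup>2 * (e * m / real n)" using e n0 by (simp add: s2_def field_simps power2_eq_square)
    also have "\<dots> \<le> (real n * p) * (e * m / real n)" using p2 e m0 n0 by (intro mult_right_mono) auto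
    also have "\<dots> = e * (p * m)" using n0 by (simp add: field_simps)
    finally show ?thesis .
  qed
  have entropy2: "s2 * ln (1 / t) \<le> e\<^sup>2 / 12 * (p * m)"
  proof -
    have "s2 * ln (1 / t) = 360 * ln (60 / e\<^sup>2) / e ^ 3 * (e\<^sup>2 / 12 * m / real n)"
      using e n0 by (simp add: s2_def t_def field_simps eval_nat_numeral)
    also have "\<dots> \<le> (real n * p) * (e\<^sup>2 / 12 * m / real n)" using p3 e m0 n0 by (intro mult_right_mono) auto
    also have "\<dots> = e\<^sup>2 / 12 * (p * m)" using n0 by (simp add: field_simps)
    finally show ?thesis .
  qed
  have entropy3: "p * t * (5 * m) = e\<^sup>2 / 12 * (p * m)" by (simp add: t_def field_simps)
  \<comment> \<open>The tilt is \<open>\<theta> = e / 3\<close>: a container has at most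
    \<open>(1 + 2 * e) * m\<close> sets, and the threshold is
    \<open>(1 + 4 * e) * (p * m)\<close>.\<close>
  have chernoff: "p * ((1 + 2 * e) * m) * (exp (e / 3) - 1) - e / 3 * ((1 + 4 * e) * (p * m)) \<le> - (e\<^sup>2 / 3) * (p * m)"
  proof -
    have "exp (e / 3) \<le> 1 + e / 3 + (e / 3)\<^sup>2" using e by (intro exp_bound) auto
    then have "(1 + 2 * e) * (exp (e / 3) - 1) \<le> (1 + 2 * e) * (e / 3 + (e / 3)\<^sup>2)"
      using e by (intro mult_left_mono) auto
    also have "\<dots> \<le> e / 3 * (1 + 4 * e) - e\<^sup>2 / 3"
    proof -
      have "(1 + 2 * e) * (e / 3) \<le> e" using e e2 by (simp add: field_simps power2_eq_square)
      then have "e / 3 * ((1 + 2 * e) * (e / 3)) \<le> e / 3 * e" using e by (intro mult_left_mono) auto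
      then show ?thesis by (simp add: field_simps power2_eq_square)
    qed
    finally have "(1 + 2 * e) * (exp (e / 3) - 1) * (p * m) \<le> (e / 3 * (1 + 4 * e) - e\<^sup>2 / 3) * (p * m)"
      using pm0 by (rule mult_right_mono)
    then show ?thesis by (simp add: algebra_simps)
  qed
  have "card {1..n} = n" by simp
  note containers = two_round_antichain_containers[OF finite_atLeastAtMost this n e(1),
      folded m_def Q_def h_def]
  obtain G H where G: "\<forall>S1. G S1 \<subseteq> Pow {1..n} \<and> real (card (G S1)) \<le> 5 * m"
    and H: "\<forall>S1 S2. H S1 S2 \<subseteq> Pow {1..n} \<and> real (card (H S1 S2)) \<le> (1 + e) * m + 8 * real n ^ 3"
    and cover: "\<forall>I. I \<subseteq> Pow {1..n} \<longrightarrow> antichain I \<longrightarrow> (\<exists>S1 S2. S1 \<subseteq> I \<and> S2 \<subseteq> I \<and> S2 \<subseteq> G S1 \<and>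
       I \<subseteq> S1 \<union> S2 \<union> H S1 S2 \<and> real (card S1) * (Q / 5) \<le> 2 ^ n \<and>
       real (card S2) * (e / (1 + e) * h) \<le> 5 * m)"
    using containers by (elim exE conjE) (rule that)
  have "measure_pmf.prob (random_family n p) {F. (1 + 6 * e) * p * m < real (max_antichain_size F)}
    \<le> exp (s1 * (real n * ln 2) + 1 + (s2 * ln (1 / t) + p * t * (5 * m))
           + (p * ((1 + 2 * e) * m) * (exp (e / 3) - 1) - e / 3 * ((1 + 4 * e) * (p * m))))"
  proof (rule prob_large_antichain_le[where G = G and H = H])
    show "0 < t" "t \<le> 1" using e e2 by (auto simp: t_def)
    \<comment> \<open>One extra \<open>e * m\<close> absorbs the extreme levels.\<close>
    show "real (card (H S1 S2)) \<le> (1 + 2 * e) * m" for S1 S2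
      using spec[OF spec[OF H], of S1 S2] n1 by (simp add: algebra_simps)
    \<comment> \<open>Of the excess \<open>6 * e\<close>, each fingerprint takes \<open>e\<close>
      and the container takes \<open>4 * e\<close>.\<close>
    show "s1 + s2 + (1 + 4 * e) * (p * m) \<le> (1 + 6 * e) * p * m"
      using s1_small s2_small by (simp add: algebra_simps)
    fix I assume "I \<subseteq> Pow {1..n}" "antichain I"
    with cover obtain S1 S2 where S: "S1 \<subseteq> I" "S2 \<subseteq> I" "S2 \<subseteq> G S1" "I \<subseteq> S1 \<union> S2 \<union> H S1 S2"
      "real (card S1) * (Q / 5) \<le> 2 ^ n" "real (card S2) * (e / (1 + e) * h) \<le> 5 * m" by meson
    have "real (card S1) \<le> s1" using S(5) Q0 by (simp add: s1_def field_simps)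
    moreover have "real (card S2) \<le> s2"
    proof -
      have "e / 2 * (real n / 3) \<le> e / (1 + e) * h"
        using e h n0 by (intro mult_mono divide_left_mono) auto
      then have "real (card S2) * (e / 2 * (real n / 3)) \<le> real (card S2) * (e / (1 + e) * h)"
        by (rule mult_left_mono) simp
      also note S(6)
      finally have "real (card S2) * (e / 2 * (real n / 3)) \<le> 5 * m" .
      then show ?thesis using e n0 by (simp add: s2_def field_simps)
    qed
    ultimately show "\<exists>S1 S2. S1 \<subseteq> I \<and> S2 \<subseteq> I \<and> S2 \<subseteq> G S1 \<and>
       I \<subseteq> S1 \<union> S2 \<union> H S1 S2 \<and> real (card S1) \<le> s1 \<and> real (card S2) \<le> s2"
      using S by blast
  qed (use p e G H in auto)
  \<comment> \<open>Three entropy terms of at most \<open>e\<^sup>2 / 12 * (p * m)\<close> each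
    leave a quarter of the Chernoff exponent \<open>e\<^sup>2 / 3 * (p * m)\<close>.\<close>
  also have "\<dots> \<le> exp (- (e\<^sup>2 / 12 * (m / real n)))"
  proof -
    have "e\<^sup>2 / 12 * (m / real n) \<le> e\<^sup>2 / 12 * (p * m)" using mp by (intro mult_left_mono) auto
    then show ?thesis
      unfolding exp_le_cancel_iff using entropy1 entropy2 entropy3 chernoff by linarith
  qed
  finally show ?thesis .
qed

theorem theorem1:
  fixes \<epsilon> :: real
  assumes "\<epsilon> > 0"
  shows "\<exists>C::real. \<forall>p :: nat \<Rightarrow> real.
           (\<forall>n. p n \<in> {0..1}) \<longrightarrow>
           (\<forall>\<^sub>F n in sequentially. p n > C / real n) \<longrightarrow>
           (\<lambda>n. measure_pmf.prob (random_family n (p n))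
                  {\<F>. real (max_antichain_size \<F>)
                        \<le> (1 + \<epsilon>) * p n * real (n choose (n div 2))})
             \<longlonglongrightarrow> 1"
proof -
  \<comment> \<open>The tail bound has excess \<open>6 * e\<close>, which must fit into
    \<open>\<epsilon>\<close>; the minimum also secures \<open>e \<le> 1\<close>.\<close>
  define e where "e = min \<epsilon> 1 / 6"
  have e: "0 < e" "e \<le> 1" "6 * e \<le> \<epsilon>" using assms by (auto simp: e_def)
  define m where "m = (\<lambda>n. real (n choose (n div 2)))"
  \<comment> \<open>The maximum of the three lower bounds on \<open>n * p\<close> that the tail
    bound requires.\<close>
  define C where "C = max 1 (max (30 / e\<^sup>2) (360 * ln (60 / e\<^sup>2) / e ^ 3))"
  have m_ge: "2 ^ n / (real n + 1) \<le> m n" for n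
    using central_binomial_ge[of n] by (simp add: m_def add.commute)
  \<comment> \<open>The failure bound depends on \<open>n\<close> only through
    \<open>m n / n\<close>, uniformly in \<open>p\<close>, so this divergence makes it
    vanish.\<close>
  have m_lim: "filterlim (\<lambda>n. m n / real n) at_top sequentially"
  proof (rule filterlim_at_top_mono)
    show "filterlim (\<lambda>n. 2 ^ n / (real n + 1) / real n) at_top sequentially" by real_asymp
  qed (intro always_eventually allI divide_right_mono m_ge, simp)
  have n1: "\<forall>\<^sub>F n in sequentially. 8 * real n ^ 3 \<le> e * m n"
  proof -
    have "\<forall>\<^sub>F n in sequentially. 8 * real n ^ 3 \<le> e * (2 ^ n / (real n + 1))"
      using e(1) by real_asymp
    moreover have "e * (2 ^ n / (real n + 1)) \<le> e * m n" for n
      using e(1) m_ge by (intro mult_left_mono) auto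
    ultimately show ?thesis by (auto elim!: eventually_mono intro: order_trans)
  qed
  have n2: "\<forall>\<^sub>F n in sequentially. 103680 * (real n + 1) / real n ^ 2 \<le> e\<^sup>2 / 24"
    using e(1) by real_asymp
  have n3: "\<forall>\<^sub>F n in sequentially. 1 \<le> e\<^sup>2 / 24 * (m n / real n)"
  proof -
    have "\<forall>\<^sub>F n in sequentially. 24 / e\<^sup>2 \<le> m n / real n"
      using m_lim by (simp add: filterlim_at_top)
    then show ?thesis by eventually_elim (use e(1) in \<open>simp add: field_simps\<close>)
  qed
  have "(\<lambda>n. measure_pmf.prob (random_family n (p n))
          {\<F>. real (max_antichain_size \<F>) \<le> (1 + \<epsilon>) * p n * m n}) \<longlonglongrightarrow> 1"
    if p: "\<forall>n. p n \<in> {0..1}" and pC: "\<forall>\<^sub>F n in sequentially. p n > C / real n" for p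
  proof (rule tendsto_sandwich)
    show "\<forall>\<^sub>F n in sequentially. 1 - exp (- (e\<^sup>2 / 12 * (m n / real n)))
        \<le> measure_pmf.prob (random_family n (p n))
          {\<F>. real (max_antichain_size \<F>) \<le> (1 + \<epsilon>) * p n * m n}"
      using n1 n2 n3 pC eventually_ge_at_top[of 8]
    proof eventually_elim
      case (elim n)
      let ?P = "random_family n (p n)"
      have "C \<le> real n * p n" using elim(4,5) by (simp add: field_simps)
      then have "measure_pmf.prob ?P {F. (1 + 6 * e) * p n * m n < real (max_antichain_size F)}
          \<le> exp (- (e\<^sup>2 / 12 * (m n / real n)))"
        unfolding m_def using elim p e(1,2)
        by (intro prob_large_antichain_le_exp) (auto simp: m_def C_def)
      moreover have "measure_pmf.prob ?P {F. (1 + 6 * e) * p n * m n < real (max_antichain_size F)}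
          = 1 - measure_pmf.prob ?P {F. real (max_antichain_size F) \<le> (1 + 6 * e) * p n * m n}"
        by (subst measure_pmf.prob_compl[symmetric]) (auto intro!: arg_cong[of _ _ "measure_pmf.prob ?P"])
      moreover have "measure_pmf.prob ?P {F. real (max_antichain_size F) \<le> (1 + 6 * e) * p n * m n}
          \<le> measure_pmf.prob ?P {F. real (max_antichain_size F) \<le> (1 + \<epsilon>) * p n * m n}"
      proof (rule measure_pmf.finite_measure_mono)
        have "(1 + 6 * e) * p n * m n \<le> (1 + \<epsilon>) * p n * m n"
          using e p by (intro mult_right_mono) (auto simp: m_def)
        then show "{F. real (max_antichain_size F) \<le> (1 + 6 * e) * p n * m n}
          \<subseteq> {F. real (max_antichain_size F) \<le> (1 + \<epsilon>) * p n * m n}" by auto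
      qed simp
      ultimately show ?case by linarith
    qed
    have "filterlim (\<lambda>n. e\<^sup>2 / 12 * (m n / real n)) at_top sequentially"
      using e(1) m_lim by (intro filterlim_tendsto_pos_mult_at_top[OF tendsto_const]) auto
    then have "(\<lambda>n. exp (- (e\<^sup>2 / 12 * (m n / real n)))) \<longlonglongrightarrow> 0"
      by (intro filterlim_compose[OF exp_at_bot] filterlim_compose[OF filterlim_uminus_at_bot_at_top])
    from tendsto_diff[OF tendsto_const this, of 1]
    show "(\<lambda>n. 1 - exp (- (e\<^sup>2 / 12 * (m n / real n)))) \<longlonglongrightarrow> 1" by simp
  qed auto
  then show ?thesis unfolding m_def by blast
qed

end
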